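(* Let $r\geq 1$ be an integer. For every real $s$ with $0\leq s<1/r$, the value $\zeta_r(s)$ is positive if $r$ is even and negative if $r$ is odd. In particular, $\zeta_r(s)$ has no zero in the interval $0\leq s<1/r$.
   Context: For an integer $r\geq 1$ and $s\in\mathbb{C}$, $\zeta_r(s)=\zeta_r(s,s,\ldots,s)=\sum_{1\leq m_1<m_2<\cdots<m_r}(m_1m_2\cdots m_r)^{-s}$ is the Euler–Zagier $r$-fold zeta-function with all arguments equal; the series converges absolutely for $\Re s>1$, and $\zeta_r(s)$ is understood via its meromorphic continuation to $\mathbb{C}$. Here $\zeta_1=\zeta$ is the Riemann zeta-function. *)

theory Defs
  imports "HOL-Complex_Analysis.Complex_Analysis"
begin

definition increasing_tuples :: "nat \<Rightarrow> nat list set" where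
  "increasing_tuples r =
     {ms. length ms = r \<and> sorted_wrt (<) ms \<and> (\<forall>m\<in>set ms. 1 \<le> m)}"

(* Meaningful only for Re s > 1: infsum is unordered (absolute) summation and
   returns 0 where the family is not summable. *)
definition euler_zagier_series :: "nat \<Rightarrow> complex \<Rightarrow> complex" where
  "euler_zagier_series r s =
     (\<Sum>\<^sub>\<infinity>ms\<in>increasing_tuples r. of_nat (prod_list ms) powr (-s))"

definition is_euler_zagier_continuation :: "nat \<Rightarrow> (complex \<Rightarrow> complex) \<Rightarrow> bool" where
  "is_euler_zagier_continuation r f \<longleftrightarrow>
     f nicely_meromorphic_on UNIV \<and> (\<forall>s. Re s > 1 \<longrightarrow> f s = euler_zagier_series r s)"

(* A nicely meromorphic function is analytic off its poles and takes the value 0 at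
   its poles; this convention is what makes the continuation unique as a function.
   A nonzero value therefore also certifies that the point is not a pole. *)
definition euler_zagier_zeta :: "nat \<Rightarrow> complex \<Rightarrow> complex" where
  "euler_zagier_zeta r = (THE f. is_euler_zagier_continuation r f)"

lemma euler_zagier_continuation_unique:
  assumes f: "is_euler_zagier_continuation r f" and g: "is_euler_zagier_continuation r g"
  shows "f = g"
proof
  fix z
  have fn: "f nicely_meromorphic_on UNIV" and gn: "g nicely_meromorphic_on UNIV"
    using f g by (auto simp: is_euler_zagier_continuation_def)
  have mer: "(\<lambda>s. f s - g s) meromorphic_on UNIV"
    using fn gn by (auto simp: nicely_meromorphic_on_def intro!: meromorphic_intros)
  have ev2: "eventually (\<lambda>s. Re s > 1) (at (2::complex))"
    by (rule eventually_at_in_open'[of "{s. Re s > 1}", simplified])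
       (auto intro: open_halfspace_Re_gt)
  have "eventually (\<lambda>s. f s - g s = 0) (cosparse UNIV)"
  proof (rule ccontr)
    assume "\<not> ?thesis"
    moreover have "(\<forall>\<^sub>\<approx>s\<in>UNIV. f s - g s = 0) \<or> (\<forall>\<^sub>\<approx>s\<in>UNIV. f s - g s \<noteq> 0)"
      by (rule meromorphic_imp_constant_or_avoid[OF mer]) auto
    ultimately have "eventually (\<lambda>s. f s - g s \<noteq> 0) (cosparse UNIV)"
      by simp
    hence "eventually (\<lambda>s. f s - g s \<noteq> 0) (at 2)"
      by (auto simp: eventually_cosparse_open_eq)
    hence "eventually (\<lambda>s. False) (at (2::complex))"
      using ev2 by eventually_elim (use f g in \<open>auto simp: is_euler_zagier_continuation_def\<close>)
    thus False by simp
  qed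
  hence ev: "eventually (\<lambda>s. f s = g s) (at z)"
    by (auto simp: eventually_cosparse_open_eq)
  hence pole: "is_pole f z \<longleftrightarrow> is_pole g z"
    by (rule is_pole_cong) auto
  show "f z = g z"
  proof (cases "is_pole f z")
    case True
    thus ?thesis
      using is_pole_zero_at_nicely_mero[OF fn] is_pole_zero_at_nicely_mero[OF gn] pole by auto
  next
    case False
    hence "f \<midarrow>z\<rightarrow> f z" "g \<midarrow>z\<rightarrow> g z"
      using fn gn pole by (auto simp: nicely_meromorphic_on_def)
    moreover have "f \<midarrow>z\<rightarrow> g z"
      using calculation(2) tendsto_cong[OF ev] by blast
    ultimately show ?thesis
      using LIM_unique by blast
  qed
qed

lemma euler_zagier_zeta_eqI:
  "is_euler_zagier_continuation r f \<Longrightarrow> euler_zagier_zeta r = f"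
  unfolding euler_zagier_zeta_def
  by (rule the_equality) (auto intro: euler_zagier_continuation_unique)

end

theory Submission
  imports Defs "HOL-Library.Ramsey"
begin

text \<open>
  For \<open>Re s > 1\<close> the series \<open>\<zeta>\<^sub>r(s)\<close> is the \<open>r\<close>-th elementary symmetric function of the numbers
  \<open>m powr (-s)\<close>, whose \<open>k\<close>-th power sum is \<open>\<zeta>(k s)\<close>. Newton's identity
  \<open>r \<zeta>\<^sub>r(s) = (\<Sum>k=1..r. (-1)^(k-1) \<zeta>(k s) \<zeta>\<^sub>r\<^sub>-\<^sub>k(s))\<close> therefore gives the continuation of \<open>\<zeta>\<^sub>r\<close> recursively
  from that of \<open>\<zeta>\<close>. If \<open>0 \<le> s < 1/r\<close>, then every \<open>k s\<close> lies in \<open>[0, 1)\<close>, where \<open>\<zeta>\<close> is negative,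
  so by induction all summands have sign \<open>(-1)^r\<close>.

  The continuation of \<open>\<zeta>(s) = \<eta>(s) / (1 - 2 powr (1-s))\<close> to the plane comes from Euler's
  transformation of the alternating series \<open>\<eta>\<close>: each step replaces the terms by their differences,
  which gains one power of \<open>n\<close>, i.e. a strip of width 1.
\<close>

subsection \<open>Newton's identity for infinitely many variables\<close>

definition power_sum :: "('a \<Rightarrow> complex) \<Rightarrow> 'a set \<Rightarrow> nat \<Rightarrow> complex" where
  "power_sum f I k = (\<Sum>\<^sub>\<infinity>m\<in>I. f m ^ k)"

definition elem_sym :: "('a \<Rightarrow> complex) \<Rightarrow> 'a set \<Rightarrow> nat \<Rightarrow> complex" where
  "elem_sym f I j = (\<Sum>\<^sub>\<infinity>A\<in>nsets I j. prod f A)"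

text \<open>
  Interpolates between \<open>power_sum * elem_sym\<close> and a multiple of \<open>elem_sym\<close>: the product
  of a power sum and an elementary symmetric function splits into two neighbouring hook sums,
  according to whether the distinguished index occurs in the set, so the alternating sum telescopes.
\<close>
definition hook_sum :: "('a \<Rightarrow> complex) \<Rightarrow> 'a set \<Rightarrow> nat \<Rightarrow> nat \<Rightarrow> complex" where
  "hook_sum f I k j = (\<Sum>\<^sub>\<infinity>(m, A)\<in>Sigma I (\<lambda>m. nsets (I - {m}) j). f m ^ k * prod f A)"

lemma elem_sym_0: "elem_sym f I 0 = 1"
proof -
  have "nsets I 0 = {{}}" by (auto simp: nsets_def)
  thus ?thesis by (simp add: elem_sym_def)
qed

text \<open>Every finite partial sum is dominated by the expanded product of
  \<open>1 + norm (f m)\<close> over finitely many indices, and \<open>1 + t \<le> exp t\<close>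
  bounds that by the exponential of the total norm.\<close>

lemma summable_prod_nsets:
  fixes f :: "'a \<Rightarrow> complex"
  assumes "f summable_on I"
  shows "(\<lambda>A. norm (prod f A)) summable_on nsets I j"
proof (rule nonneg_bdd_above_summable_on)
  have nf: "(\<lambda>x. norm (f x)) summable_on I"
    using assms by (simp add: summable_on_iff_abs_summable_on_complex)
  show "bdd_above (sum (\<lambda>A. norm (prod f A)) ` {F. F \<subseteq> nsets I j \<and> finite F})"
  proof (rule bdd_aboveI2)
    fix F assume "F \<in> {F. F \<subseteq> nsets I j \<and> finite F}"
    hence F: "finite F" "\<And>A. A \<in> F \<Longrightarrow> A \<subseteq> I \<and> finite A" by (auto simp: nsets_def)
    define U where "U = \<Union>F"
    have U: "finite U" "U \<subseteq> I" "F \<subseteq> Pow U" using F by (auto simp: U_def)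
    have "(\<Sum>A\<in>F. norm (prod f A)) \<le> (\<Sum>A\<in>Pow U. norm (prod f A))"
      using U by (intro sum_mono2) auto
    also have "\<dots> = (\<Prod>m\<in>U. norm (f m) + 1)"
      using U by (simp add: prod_add prod_norm)
    also have "\<dots> \<le> (\<Prod>m\<in>U. exp (norm (f m)))"
      by (intro prod_mono) (auto intro: exp_ge_add_one_self simp: add.commute add_nonneg_nonneg)
    also have "\<dots> = exp (\<Sum>m\<in>U. norm (f m))" using U by (simp add: exp_sum)
    also have "\<dots> \<le> exp (\<Sum>\<^sub>\<infinity>m\<in>I. norm (f m))"
      using finite_sum_le_infsum[OF nf U(1,2)] by simp
    finally show "(\<Sum>A\<in>F. norm (prod f A)) \<le> exp (\<Sum>\<^sub>\<infinity>m\<in>I. norm (f m))" .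
  qed
qed auto

text \<open>All \<open>norm (f m)\<close> are at most their total \<open>S\<close>, so
  \<open>k - 1\<close> of the factors can be replaced by \<open>S\<close>.\<close>

lemma summable_power:
  fixes f :: "'a \<Rightarrow> complex"
  assumes "f summable_on I" "k > 0"
  shows "(\<lambda>m. norm (f m ^ k)) summable_on I"
proof (rule nonneg_bdd_above_summable_on)
  have nf: "(\<lambda>x. norm (f x)) summable_on I"
    using assms by (simp add: summable_on_iff_abs_summable_on_complex)
  define S where "S = (\<Sum>\<^sub>\<infinity>m\<in>I. norm (f m))"
  show "bdd_above (sum (\<lambda>m. norm (f m ^ k)) ` {F. F \<subseteq> I \<and> finite F})"
  proof (rule bdd_aboveI2)
    fix F assume "F \<in> {F. F \<subseteq> I \<and> finite F}"
    hence F: "finite F" "F \<subseteq> I" by auto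
    have le: "norm (f m) \<le> S" if "m \<in> F" for m
      using finite_sum_le_infsum[OF nf, of "{m}"] that F by (auto simp: S_def)
    have "(\<Sum>m\<in>F. norm (f m ^ k)) \<le> (\<Sum>m\<in>F. norm (f m) * S ^ (k - 1))"
    proof (rule sum_mono)
      fix m assume "m \<in> F"
      have "norm (f m ^ k) = norm (f m) * norm (f m) ^ (k - 1)"
        using assms(2) by (cases k) (simp_all add: norm_power norm_mult)
      also have "\<dots> \<le> norm (f m) * S ^ (k - 1)"
        using le[OF \<open>m \<in> F\<close>] by (intro mult_left_mono power_mono) auto
      finally show "norm (f m ^ k) \<le> norm (f m) * S ^ (k - 1)" .
    qed
    also have "\<dots> = (\<Sum>m\<in>F. norm (f m)) * S ^ (k - 1)" by (simp add: sum_distrib_right)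
    also have "\<dots> \<le> S * S ^ (k - 1)"
      using finite_sum_le_infsum[OF nf F] by (intro mult_right_mono) (auto simp: S_def infsum_nonneg)
    finally show "(\<Sum>m\<in>F. norm (f m ^ k)) \<le> S * S ^ (k - 1)" .
  qed
qed auto

lemma summable_power_prod:
  fixes f :: "'a \<Rightarrow> complex"
  assumes "f summable_on I" "k > 0"
  shows "(\<lambda>(m, A). f m ^ k * prod f A) summable_on I \<times> nsets I j"
proof -
  note sm = summable_power[OF assms] summable_prod_nsets[OF assms(1), of j]
  note sm = summable_power[OF assms] summable_prod_nsets[OF assms(1), of j]
  have "(\<lambda>x. norm (case x of (m, A) \<Rightarrow> f m ^ k * prod f A)) summable_on I \<times> nsets I j"
  proof (subst Infinite_Sum.abs_summable_on_Sigma_iff, intro conjI ballI)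
    show "(\<lambda>A. norm (case (m, A) of (m, A) \<Rightarrow> f m ^ k * prod f A)) summable_on nsets I j" for m
      using summable_on_cmult_right[OF sm(2), of "norm (f m ^ k)"] by (simp add: norm_mult)
    show "(\<lambda>m. norm (\<Sum>\<^sub>\<infinity>A\<in>nsets I j. norm (case (m, A) of (m, A) \<Rightarrow> f m ^ k * prod f A))) summable_on I"
      using summable_on_cmult_left[OF sm(1), of "\<Sum>\<^sub>\<infinity>A\<in>nsets I j. norm (prod f A)"]
      by (simp add: norm_mult infsum_cmult_right' abs_mult infsum_nonneg)
  qed
  thus ?thesis
    by (rule abs_summable_summable)
qed

section \<open>Products of power sums and elementary symmetric functions\<close>

lemma power_sum_mult_elem_sym_eq:
  assumes "f summable_on I" "k > 0"
  shows "power_sum f I k * elem_sym f I j =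
    (\<Sum>\<^sub>\<infinity>(m, A)\<in>I \<times> nsets I j. f m ^ k * prod f A)"
proof -
  have "(\<Sum>\<^sub>\<infinity>(m, A)\<in>I \<times> nsets I j. f m ^ k * prod f A) =
      (\<Sum>\<^sub>\<infinity>m\<in>I. \<Sum>\<^sub>\<infinity>A\<in>nsets I j. f m ^ k * prod f A)"
    using infsum_Sigma'_banach[OF summable_power_prod[OF assms]] by simp
  thus ?thesis
    by (simp add: power_sum_def elem_sym_def infsum_cmult_right' infsum_cmult_left')
qed

lemma power_sum_mult_elem_sym_0:
  assumes "f summable_on I" "k > 0"
  shows "power_sum f I k * elem_sym f I 0 = hook_sum f I k 0"
proof -
  have *: "nsets J 0 = {{}}" for J :: "'a set" by (auto simp: nsets_def)
  show ?thesis
    using power_sum_mult_elem_sym_eq[OF assms, of 0] by (simp add: * hook_sum_def)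
qed

lemma power_sum_mult_elem_sym_Suc:
  fixes f :: "'a \<Rightarrow> complex"
  assumes "f summable_on I" "k > 0"
  shows "power_sum f I k * elem_sym f I (Suc j) = hook_sum f I k (Suc j) + hook_sum f I (Suc k) j"
proof -
  define g where "g = (\<lambda>(m, A). f m ^ k * prod f A)"
  define P where "P = Sigma I (\<lambda>m. nsets (I - {m}) (Suc j))"
  define Q where "Q = Sigma I (\<lambda>m. {A \<in> nsets I (Suc j). m \<in> A})"
  have PQ: "I \<times> nsets I (Suc j) = P \<union> Q" "P \<inter> Q = {}"
    by (auto simp: P_def Q_def nsets_def)
  have sm: "g summable_on I \<times> nsets I (Suc j)"
    unfolding g_def by (rule summable_power_prod[OF assms])
  have "power_sum f I k * elem_sym f I (Suc j) = infsum g (I \<times> nsets I (Suc j))"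
    unfolding g_def by (rule power_sum_mult_elem_sym_eq[OF assms])
  also have "\<dots> = infsum g P + infsum g Q"
    unfolding PQ(1)
    by (rule infsum_Un_disjoint) (use sm PQ in \<open>auto intro: summable_on_subset\<close>)
  also have "infsum g P = hook_sum f I k (Suc j)"
    by (simp add: g_def P_def hook_sum_def)
  \<comment> \<open>On \<open>Q\<close> the index m lies in A; deleting it from A moves one factor
    \<open>f m\<close> from the product into the power.\<close>
  also have "infsum g Q = hook_sum f I (Suc k) j"
    unfolding hook_sum_def
  proof (rule infsum_reindex_bij_witness[where i = "\<lambda>(m, A). (m, insert m A)" and j = "\<lambda>(m, A). (m, A - {m})"])
    fix x assume x: "x \<in> Q"
    obtain m A where mA: "x = (m, A)" by (cases x)
    have "prod f A = f m * prod f (A - {m})"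
      using x by (intro prod.remove) (auto simp: mA Q_def nsets_def)
    with x show "(case x of (m, A) \<Rightarrow> (m, A - {m})) \<in> Sigma I (\<lambda>m. nsets (I - {m}) j)"
      and "(case case x of (m, A) \<Rightarrow> (m, A - {m}) of (m, A) \<Rightarrow> (m, insert m A)) = x"
      and "(case case x of (m, A) \<Rightarrow> (m, A - {m}) of (m, A) \<Rightarrow> f m ^ Suc k * prod f A) = g x"
      by (auto simp: mA Q_def nsets_def g_def insert_absorb)
  next
    fix x assume "x \<in> Sigma I (\<lambda>m. nsets (I - {m}) j)"
    thus "(case x of (m, A) \<Rightarrow> (m, insert m A)) \<in> Q"
      and "(case case x of (m, A) \<Rightarrow> (m, insert m A) of (m, A) \<Rightarrow> (m, A - {m})) = x"
      by (auto simp: Q_def nsets_def card_insert_if)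
  qed
  finally show ?thesis .
qed

text \<open>For \<open>k = 1\<close> the distinguished factor is like all the others: (m, A)
  contributes the product over \<open>insert m A\<close>, and every set of size \<open>Suc j\<close>
  arises once for each of its elements.\<close>

lemma hook_sum_1:
  fixes f :: "'a \<Rightarrow> complex"
  assumes "f summable_on I"
  shows "hook_sum f I 1 j = of_nat (Suc j) * elem_sym f I (Suc j)"
proof -
  define S where "S = Sigma I (\<lambda>m. nsets (I - {m}) j)"
  define g where "g = (\<lambda>(m, A). f m ^ 1 * prod f A)"
  define R where "R = Sigma (nsets I (Suc j)) (\<lambda>A. A)"
  have bij: "bij_betw (\<lambda>(A, m). (m, A - {m})) R S"
    by (rule bij_betwI[where g = "\<lambda>(m, A). (insert m A, m)"])
       (auto simp: R_def S_def nsets_def card_insert_if)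
  have "g summable_on S"
    unfolding g_def
    by (rule summable_on_subset_banach[OF summable_power_prod[OF assms, of 1 j]])
       (auto simp: S_def nsets_def)
  hence sm: "(\<lambda>x. g (case x of (A, m) \<Rightarrow> (m, A - {m}))) summable_on R"
    using summable_on_reindex_bij_betw[OF bij, of g] by simp
  have eq: "g (case x of (A, m) \<Rightarrow> (m, A - {m})) = prod f (fst x)" if "x \<in> R" for x
    using that prod.remove[of "fst x" "snd x" f] by (auto simp: R_def g_def nsets_def)
  have sm': "(\<lambda>(A, m). prod f A) summable_on R"
    using sm by (rule summable_on_cong[THEN iffD1, rotated]) (use eq in auto)
  have "hook_sum f I 1 j = infsum g S" by (simp add: hook_sum_def g_def S_def)
  also have "\<dots> = infsum (\<lambda>x. g (case x of (A, m) \<Rightarrow> (m, A - {m}))) R"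
    using infsum_reindex_bij_betw[OF bij, of g] by simp
  also have "\<dots> = infsum (\<lambda>(A, m). prod f A) R"
    by (rule infsum_cong) (use eq in auto)
  also have "\<dots> = (\<Sum>\<^sub>\<infinity>A\<in>nsets I (Suc j). \<Sum>\<^sub>\<infinity>m\<in>A. prod f A)"
    unfolding R_def by (rule infsum_Sigma'_banach[symmetric, OF sm'[unfolded R_def]])
  also have "\<dots> = (\<Sum>\<^sub>\<infinity>A\<in>nsets I (Suc j). of_nat (Suc j) * prod f A)"
    by (rule infsum_cong) (auto simp: nsets_def)
  also have "\<dots> = of_nat (Suc j) * elem_sym f I (Suc j)"
    by (simp only: elem_sym_def infsum_cmult_right')
  finally show ?thesis .
qed

text \<open>Solving \<open>power_sum_mult_elem_sym_Suc\<close> for its first hook sum gives a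
  recursion that raises \<open>k\<close> and lowers \<open>j\<close>; iterating it produces the
  alternating sum.\<close>

lemma hook_sum_eq:
  fixes f :: "'a \<Rightarrow> complex"
  assumes "f summable_on I" "k > 0"
  shows "hook_sum f I k j = (\<Sum>i\<le>j. (-1) ^ i * power_sum f I (k + i) * elem_sym f I (j - i))"
  using assms(2)
proof (induction j arbitrary: k)
  case 0
  thus ?case using power_sum_mult_elem_sym_0[OF assms(1)] by simp
next
  case (Suc j)
  have "(\<Sum>i\<le>Suc j. (-1) ^ i * power_sum f I (k + i) * elem_sym f I (Suc j - i)) =
      power_sum f I k * elem_sym f I (Suc j) - hook_sum f I (Suc k) j"
    by (subst sum.atMost_Suc_shift) (simp add: Suc.IH[of "Suc k"] sum_negf)
  thus ?case using power_sum_mult_elem_sym_Suc[OF assms(1) Suc.prems, of j] by simp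
qed

lemma newton_identity:
  fixes f :: "'a \<Rightarrow> complex"
  assumes "f summable_on I"
  shows "of_nat (Suc j) * elem_sym f I (Suc j) =
    (\<Sum>i\<le>j. (-1) ^ i * power_sum f I (Suc i) * elem_sym f I (j - i))"
  using hook_sum_eq[OF assms, of 1 j] hook_sum_1[OF assms, of j] by simp

section \<open>Euler-Zagier series as elementary symmetric functions\<close>

lemma bij_betw_increasing_tuples: "bij_betw set (increasing_tuples r) (nsets {1..} r)"
proof (rule bij_betwI[where g = sorted_list_of_set])
  show "set \<in> increasing_tuples r \<rightarrow> nsets {1..} r"
    by (auto simp: increasing_tuples_def nsets_def strict_sorted_iff distinct_card)
  show "sorted_list_of_set \<in> nsets {1..} r \<rightarrow> increasing_tuples r"
    by (auto simp: increasing_tuples_def nsets_def)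
  show "sorted_list_of_set (set x) = x" if "x \<in> increasing_tuples r" for x
    using that by (auto simp: increasing_tuples_def strict_sorted_iff sorted_list_of_set.idem_if_sorted_distinct)
  show "set (sorted_list_of_set A) = A" if "A \<in> nsets {1..} r" for A
    using that by (auto simp: nsets_def)
qed

text \<open>Complex powers are not multiplicative in the base in general; here both bases are
  nonnegative reals.\<close>

lemma of_nat_mult_powr:
  "of_nat (m * n) powr s = (of_nat m powr s * of_nat n powr s :: complex)"
  using powr_times_real[of "of_nat m" "of_nat n" s] by simp

lemma euler_zagier_series_eq_elem_sym:
  "euler_zagier_series r s = elem_sym (\<lambda>m. of_nat m powr (-s)) {1..} r"
proof -
  have eq: "of_nat (prod_list ms) powr (-s) = (\<Prod>m\<in>set ms. of_nat m powr (-s) :: complex)"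
    if "distinct ms" for ms
    using that by (induction ms) (simp_all only: prod_list.Cons of_nat_mult_powr, simp_all)
  have "elem_sym (\<lambda>m. of_nat m powr (-s)) {1..} r =
      (\<Sum>\<^sub>\<infinity>ms\<in>increasing_tuples r. \<Prod>m\<in>set ms. of_nat m powr (-s))"
    unfolding elem_sym_def
    by (rule infsum_reindex_bij_betw[OF bij_betw_increasing_tuples, symmetric])
  also have "\<dots> = euler_zagier_series r s"
    unfolding euler_zagier_series_def
    by (rule infsum_cong, subst eq) (auto simp: increasing_tuples_def strict_sorted_iff)
  finally show ?thesis by simp
qed

subsection \<open>Continuation of the Riemann zeta function\<close>

text \<open>The \<open>K\<close>-th iterated difference of \<open>x powr (-s)\<close>, with the sign
  convention \<open>g x - g (x + 1)\<close>. The real argument allows differentiation in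
  \<open>x\<close>.\<close>

fun powr_difference :: "nat \<Rightarrow> complex \<Rightarrow> real \<Rightarrow> complex" where
  "powr_difference 0 s x = of_real x powr (-s)"
| "powr_difference (Suc K) s x = powr_difference K s x - powr_difference K s (x + 1)"

text \<open>Euler's transformation after \<open>K\<close> steps: each step splits off half of the
  leading term and leaves half of an alternating series of differences. For \<open>K = 0\<close>
  this is the eta series itself.\<close>

definition eta_trafo :: "nat \<Rightarrow> complex \<Rightarrow> complex" where
  "eta_trafo K s = (\<Sum>j<K. powr_difference j s 1 / 2 ^ Suc j)
     + (\<Sum>n. (-1) ^ n * powr_difference K s (real n + 1)) / 2 ^ K"

text \<open>
  The number of transformation steps is chosen large enough for absolute convergence at \<open>s\<close>;
  any larger number gives the same value.
\<close>
definition dirichlet_eta :: "complex \<Rightarrow> complex" where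
  "dirichlet_eta s = eta_trafo (nat \<lceil>2 - Re s\<rceil>) s"

text \<open>Zeros of the denominator lie on \<open>Re s = 1\<close>; there division by zero yields 0
  even if the singularity is removable. Such values are corrected when \<open>remove_sings\<close>
  is applied to \<open>multi_zeta\<close>.\<close>

definition zeta :: "complex \<Rightarrow> complex" where
  "zeta s = dirichlet_eta s / (1 - 2 powr (1 - s))"

section \<open>Decay of the iterated differences\<close>

lemma has_vector_derivative_powr_difference:
  assumes "x > 0"
  shows "(powr_difference K s has_vector_derivative - s * powr_difference K (s + 1) x) (at x within A)"
  using assms
proof (induction K arbitrary: x A)
  case 0
  have "((\<lambda>z. z powr (-s)) has_field_derivative - s * of_real x powr (- s - 1)) (at (of_real x))"
    using 0 by (auto intro!: derivative_eq_intros simp: field_simps)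
  moreover have "- s - 1 = - (s + 1)" by simp
  ultimately have "((\<lambda>z. z powr (-s)) has_field_derivative - s * of_real x powr (- (s + 1))) (at (of_real x))"
    by metis
  from has_vector_derivative_real_field[OF this] show ?case by simp
next
  case (Suc K)
  have "((\<lambda>x. powr_difference K s (x + 1)) has_vector_derivative 1 *\<^sub>R (- s * powr_difference K (s + 1) (x + 1))) (at x within A)"
  proof (rule vector_diff_chain_within[of "\<lambda>x. x + 1" 1 x A "powr_difference K s", unfolded o_def])
    show "((\<lambda>x. x + 1) has_vector_derivative 1) (at x within A)"
      by (auto intro!: derivative_eq_intros)
  qed (use Suc in auto)
  from has_vector_derivative_diff[OF Suc.IH[OF Suc.prems, of A] this] show ?case
    by (simp add: algebra_simps)
qed

text \<open>Mean value inequality on an interval of length 1: one more difference costs a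
  derivative, which is \<open>- s\<close> times the previous difference at \<open>s + 1\<close>. The
  factors \<open>s\<close>, \<open>s + 1\<close>, ... collect into the Pochhammer symbol. The
  assumption on \<open>Re s\<close> makes the bounding power nonincreasing, hence largest at the
  left end \<open>x\<close>.\<close>

lemma norm_powr_difference_le:
  assumes "x > 0" "Re s + real K \<ge> 0"
  shows "norm (powr_difference K s x) \<le> norm (pochhammer s K) * x powr (- Re s - real K)"
  using assms
proof (induction K arbitrary: s x)
  case 0
  thus ?case by (simp add: norm_powr_real_powr)
next
  case (Suc K)
  define B where "B = norm (pochhammer s (Suc K)) * x powr (- Re s - real (Suc K))"
  have "norm (powr_difference K s x - powr_difference K s (x + 1)) \<le> B * norm (x - (x + 1))"
  proof (rule differentiable_bound[where S = "{x..x+1}"])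
    fix t assume t: "t \<in> {x..x+1}"
    with Suc.prems have "t > 0" by auto
    show "(powr_difference K s has_derivative (\<lambda>h. h *\<^sub>R (- s * powr_difference K (s + 1) t))) (at t within {x..x+1})"
      using has_vector_derivative_powr_difference[OF \<open>t > 0\<close>]
      by (simp add: has_vector_derivative_def)
    have "norm (- s * powr_difference K (s + 1) t) \<le> norm s * (norm (pochhammer (s + 1) K) * t powr (- Re (s + 1) - real K))"
      using Suc.IH[of t "s + 1"] Suc.prems \<open>t > 0\<close> by (auto simp: norm_mult intro!: mult_left_mono)
    also have "\<dots> = norm (pochhammer s (Suc K)) * t powr (- Re s - real (Suc K))"
    proof -
      have "- Re (s + 1) - real K = - Re s - real (Suc K)" by simp
      thus ?thesis by (simp only: pochhammer_rec norm_mult mult.assoc)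
    qed
    also have "\<dots> \<le> B"
      unfolding B_def using Suc.prems t by (intro mult_left_mono powr_mono2') auto
    finally show "onorm (\<lambda>h. h *\<^sub>R (- s * powr_difference K (s + 1) t)) \<le> B"
      by (intro onorm_le) (simp add: mult_left_mono mult.commute[of B])
  qed auto
  thus ?case by (simp add: B_def)
qed

lemma summable_Suc_powr:
  assumes "a < -1"
  shows "summable (\<lambda>n. (real n + 1) powr a)"
proof -
  have "summable (\<lambda>n. real (Suc n) powr a)"
    using assms by (subst summable_Suc_iff) (simp add: summable_real_powr_iff)
  thus ?thesis by (simp add: add.commute)
qed

lemma summable_norm_powr_difference:
  assumes "Re s + real K > 1"
  shows "summable (\<lambda>n. norm (powr_difference K s (real n + 1)))"
proof (rule summable_comparison_test')
  show "summable (\<lambda>n. norm (pochhammer s K) * (real n + 1) powr (- Re s - real K))"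
    using assms by (intro summable_mult summable_Suc_powr) auto
  show "norm (norm (powr_difference K s (real n + 1))) \<le> norm (pochhammer s K) * (real n + 1) powr (- Re s - real K)" for n
    using norm_powr_difference_le[of "real n + 1" s K] assms by simp
qed

lemma summable_alternating_powr_difference:
  assumes "Re s + real K > 1"
  shows "summable (\<lambda>n. (-1) ^ n * powr_difference K s (real n + 1))"
  by (rule summable_norm_cancel) (use summable_norm_powr_difference[OF assms] in \<open>simp add: norm_mult norm_power\<close>)

section \<open>Euler's transformation\<close>

lemma alternating_sum_by_parts:
  fixes a :: "nat \<Rightarrow> 'a :: real_normed_field"
  assumes "summable (\<lambda>n. (-1) ^ n * a n)"
  shows "(\<Sum>n. (-1) ^ n * a n) = a 0 / 2 + (\<Sum>n. (-1) ^ n * (a n - a (Suc n))) / 2"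
proof -
  define S where "S = (\<Sum>n. (-1) ^ n * a n)"
  have S: "(\<lambda>n. (-1) ^ n * a n) sums S" using assms by (simp add: S_def summable_sums)
  hence "(\<lambda>n. (-1) ^ Suc n * a (Suc n)) sums (S - a 0)"
    using sums_split_initial_segment[OF S, of 1] by simp
  \<comment> \<open>Adding the series to its own shift produces the differences and counts every
    term but the first twice.\<close>
  from sums_add[OF S this] have "(\<lambda>n. (-1) ^ n * (a n - a (Suc n))) sums (S + (S - a 0))"
    by (simp add: algebra_simps)
  from sums_unique[OF this] have "(\<Sum>n. (-1) ^ n * (a n - a (Suc n))) = 2 * S - a 0" by simp
  thus ?thesis unfolding S_def[symmetric] by (simp add: diff_divide_distrib)
qed

text \<open>Plain summability is assumed instead of \<open>Re s + real K > 1\<close> because the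
  boundary case \<open>K = 1\<close>, \<open>s = 0\<close> enters the proof that eta is
  positive.\<close>

lemma eta_trafo_Suc:
  assumes "summable (\<lambda>n. (-1) ^ n * powr_difference K s (real n + 1))"
  shows "eta_trafo (Suc K) s = eta_trafo K s"
proof -
  have "(\<Sum>n. (-1) ^ n * powr_difference K s (real n + 1)) =
      powr_difference K s 1 / 2 + (\<Sum>n. (-1) ^ n * powr_difference (Suc K) s (real n + 1)) / 2"
    using alternating_sum_by_parts[OF assms] by (simp add: add_ac)
  thus ?thesis
    by (simp add: eta_trafo_def add_divide_distrib mult.commute del: powr_difference.simps)
qed

lemma eta_trafo_mono:
  assumes "Re s + real K > 1" "K \<le> L"
  shows "eta_trafo L s = eta_trafo K s"
  using assms(2)
proof (induction L rule: dec_induct)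
  case (step L)
  thus ?case
    using assms(1) by (subst eta_trafo_Suc) (auto intro!: summable_alternating_powr_difference)
qed auto

lemma dirichlet_eta_eq:
  assumes "Re s + real K > 1"
  shows "dirichlet_eta s = eta_trafo K s"
proof -
  define L where "L = nat \<lceil>2 - Re s\<rceil>"
  have L: "Re s + real L > 1" unfolding L_def by linarith
  show ?thesis
    using eta_trafo_mono[OF L, of "max K L"] eta_trafo_mono[OF assms, of "max K L"]
    by (simp add: dirichlet_eta_def L_def)
qed

section \<open>Holomorphy of eta\<close>

lemma holomorphic_powr_difference: "(\<lambda>s. powr_difference K s x) holomorphic_on S"
  by (induction K arbitrary: x) (auto intro!: holomorphic_intros)

lemma holomorphic_eta_trafo: "eta_trafo K holomorphic_on {s. Re s > 1 - real K}"
proof -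
  let ?S = "{s. Re s > 1 - real K}"
  have "(\<lambda>s. \<Sum>n. (-1) ^ n * powr_difference K s (real n + 1)) holomorphic_on ?S"
  proof (rule holomorphic_uniform_sequence)
    show "open ?S" by (rule open_halfspace_Re_gt)
    show "(\<lambda>s. \<Sum>i<n. (-1) ^ i * powr_difference K s (real i + 1)) holomorphic_on ?S" for n
      by (intro holomorphic_intros holomorphic_powr_difference)
  next
    fix z assume z: "z \<in> ?S"
    \<comment> \<open>Half the distance from z to the edge of the half-plane: on
      \<open>cball z d\<close> the exponents stay at most \<open>- 1 - d\<close>, which gives a
      summable majorant.\<close>
    define d where "d = (Re z + real K - 1) / 2"
    have "d > 0" using z by (simp add: d_def)
    have Re: "Re s + real K \<ge> 1 + d" if "s \<in> cball z d" for s
      using complex_Re_le_cmod[of "z - s"] that by (simp add: d_def dist_norm field_simps)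
    have "compact ((\<lambda>s. pochhammer s K) ` cball z d)"
      by (intro compact_continuous_image) (auto simp: pochhammer_prod intro!: continuous_intros)
    then obtain C where C: "\<And>s. s \<in> cball z d \<Longrightarrow> norm (pochhammer s K) \<le> C"
      using compact_imp_bounded by (fastforce simp: bounded_iff)
    have "uniform_limit (cball z d) (\<lambda>n s. \<Sum>i<n. (-1) ^ i * powr_difference K s (real i + 1))
        (\<lambda>s. \<Sum>n. (-1) ^ n * powr_difference K s (real n + 1)) sequentially"
    proof (rule Weierstrass_m_test)
      show "summable (\<lambda>n. C * (real n + 1) powr (- 1 - d))"
        using \<open>d > 0\<close> by (intro summable_mult summable_Suc_powr) auto
      fix n s assume s: "s \<in> cball z d"
      have "norm ((-1) ^ n * powr_difference K s (real n + 1)) \<le>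
          norm (pochhammer s K) * (real n + 1) powr (- Re s - real K)"
        using norm_powr_difference_le[of "real n + 1" s K] Re[OF s] \<open>d > 0\<close> by (simp add: norm_mult norm_power)
      also have "\<dots> \<le> C * (real n + 1) powr (- 1 - d)"
        using C[OF s] Re[OF s] order_trans[OF norm_ge_zero C[OF s]]
        by (intro mult_mono powr_mono) auto
      finally show "norm ((-1) ^ n * powr_difference K s (real n + 1)) \<le> C * (real n + 1) powr (- 1 - d)" .
    qed
    moreover have "cball z d \<subseteq> ?S" using Re \<open>d > 0\<close> by force
    ultimately show "\<exists>d>0. cball z d \<subseteq> ?S \<and> uniform_limit (cball z d)
        (\<lambda>n s. \<Sum>i<n. (-1) ^ i * powr_difference K s (real i + 1))
        (\<lambda>s. \<Sum>n. (-1) ^ n * powr_difference K s (real n + 1)) sequentially"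
      using \<open>d > 0\<close> by blast
  qed
  thus ?thesis
    unfolding eta_trafo_def by (intro holomorphic_intros holomorphic_powr_difference) auto
qed

text \<open>The number of steps in \<open>dirichlet_eta\<close> jumps from strip to strip, but on a
  whole half-plane around z all choices agree with a single \<open>eta_trafo K\<close>.\<close>

lemma analytic_dirichlet_eta: "dirichlet_eta analytic_on A"
proof -
  have "dirichlet_eta analytic_on {z}" for z
  proof -
    define K where "K = nat \<lceil>2 - Re z\<rceil>"
    have "dirichlet_eta holomorphic_on {s. Re s > 1 - real K}"
      by (rule holomorphic_transform[OF holomorphic_eta_trafo]) (auto simp: dirichlet_eta_eq[of _ K])
    moreover have "z \<in> {s. Re s > 1 - real K}" by (simp add: K_def) linarith
    ultimately show ?thesis
      using open_halfspace_Re_gt[of "1 - real K"] by (auto simp: analytic_at)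
  qed
  thus ?thesis by (subst analytic_on_analytic_at) auto
qed

section \<open>Relation between eta and zeta\<close>

lemma dirichlet_eta_eq_zeta_sum:
  assumes "Re s > 1"
  shows "dirichlet_eta s = (1 - 2 powr (1 - s)) * (\<Sum>n. of_nat (Suc n) powr (-s))"
proof -
  define f where "f = (\<lambda>n. of_nat (Suc n) powr (-s) :: complex)"
  have f: "powr_difference 0 s (real n + 1) = f n" for n by (simp add: f_def add.commute)
  have "summable f"
    using summable_norm_powr_difference[of s 0, unfolded f] assms by (simp add: summable_norm_cancel)
  have "dirichlet_eta s = eta_trafo 0 s" using assms by (intro dirichlet_eta_eq) simp
  also have "\<dots> = (\<Sum>n. (-1) ^ n * f n)" by (simp only: eta_trafo_def f) simp
  finally have alt: "(\<lambda>n. (-1) ^ n * f n) sums dirichlet_eta s"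
    using summable_sums[OF summable_alternating_powr_difference[of s 0, unfolded f]] assms by simp
  \<comment> \<open>As \<open>f n\<close> belongs to the integer \<open>n + 1\<close>, the terms
    with even n cancel and those with odd n double: they are the even integers, and a factor
    \<open>2 powr (1 - s)\<close> comes out.\<close>
  have "(\<lambda>n. f n - (-1) ^ n * f n) sums (suminf f - dirichlet_eta s)"
    by (intro sums_diff alt summable_sums \<open>summable f\<close>)
  moreover have "strict_mono (\<lambda>m::nat. 2 * m + 1)" by (auto intro!: strict_monoI)
  moreover have "f n - (-1) ^ n * f n = 0" if "n \<notin> range (\<lambda>m. 2 * m + 1)" for n
  proof -
    have "even n"
    proof (rule ccontr)
      assume "odd n"
      then obtain m where "n = 2 * m + 1" by (rule oddE)
      with that show False by blast
    qed
    thus ?thesis by simp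
  qed
  ultimately have "(\<lambda>m. f (2 * m + 1) - (-1) ^ (2 * m + 1) * f (2 * m + 1)) sums (suminf f - dirichlet_eta s)"
    using sums_mono_reindex[of "\<lambda>m. 2 * m + 1" "\<lambda>n. f n - (-1) ^ n * f n"] by blast
  moreover have "(\<lambda>m. f (2 * m + 1) - (-1) ^ (2 * m + 1) * f (2 * m + 1)) = (\<lambda>m. 2 powr (1 - s) * f m)"
  proof
    fix m
    have "f (2 * m + 1) = of_nat (2 * Suc m) powr (-s)" by (simp add: f_def)
    also have "\<dots> = 2 powr (-s) * f m" by (simp only: of_nat_mult_powr f_def of_nat_numeral)
    finally have "f (2 * m + 1) - (-1) ^ (2 * m + 1) * f (2 * m + 1) = 2 * 2 powr (-s) * f m" by simp
    also have "2 * 2 powr (-s) = (2 powr (1 - s) :: complex)"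
      using powr_add[of "2 :: complex" 1 "-s"] by simp
    finally show "f (2 * m + 1) - (-1) ^ (2 * m + 1) * f (2 * m + 1) = 2 powr (1 - s) * f m" .
  qed
  ultimately have "(\<lambda>m. 2 powr (1 - s) * f m) sums (suminf f - dirichlet_eta s)"
    by (simp only:)
  moreover have "(\<lambda>m. 2 powr (1 - s) * f m) sums (2 powr (1 - s) * suminf f)"
    by (intro sums_mult summable_sums \<open>summable f\<close>)
  ultimately have "suminf f - dirichlet_eta s = 2 powr (1 - s) * suminf f"
    by (rule sums_unique2)
  hence "dirichlet_eta s = (1 - 2 powr (1 - s)) * suminf f"
    by (simp add: algebra_simps)
  thus ?thesis by (simp only: f_def)
qed

section \<open>Analyticity and sign of zeta\<close>

lemma two_powr_neq_1:
  assumes "Re s \<noteq> 1"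
  shows "1 - 2 powr (1 - s) \<noteq> (0 :: complex)"
proof
  assume "1 - 2 powr (1 - s) = 0"
  hence "norm (2 powr (1 - s) :: complex) = 1" by simp
  hence "2 powr (1 - Re s) = (1 :: real)" by (simp add: norm_powr_real_powr)
  thus False using assms by simp
qed

lemma has_sum_zeta:
  assumes "Re s > 1"
  shows "((\<lambda>m. of_nat m powr (-s)) has_sum zeta s) {1..}"
proof -
  have "summable (\<lambda>n. norm (powr_difference 0 s (real n + 1)))"
    using assms by (intro summable_norm_powr_difference) auto
  hence sm: "summable (\<lambda>n. norm (of_nat (Suc n) powr (-s) :: complex))"
    by (simp add: add.commute)
  have "(\<lambda>n. of_nat (Suc n) powr (-s)) sums zeta s"
    using summable_sums[OF summable_norm_cancel[OF sm]] assms two_powr_neq_1[of s]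
    by (simp add: zeta_def dirichlet_eta_eq_zeta_sum del: of_nat_Suc)
  from norm_summable_imp_has_sum[OF sm this]
  have "((\<lambda>m. of_nat m powr (-s)) has_sum zeta s) (range Suc)"
    by (subst has_sum_reindex) (auto simp: o_def)
  moreover have "range Suc = {1..}" by (auto simp: image_def Suc_le_eq gr0_conv_Suc)
  ultimately show ?thesis by simp
qed

lemma meromorphic_zeta: "zeta meromorphic_on A"
  unfolding zeta_def
  by (intro meromorphic_on_divide analytic_on_imp_meromorphic_on analytic_dirichlet_eta)
     (auto intro!: analytic_intros)

lemma analytic_zeta:
  assumes "Re s \<noteq> 1"
  shows "zeta analytic_on {s}"
  unfolding zeta_def
  by (intro analytic_on_divide analytic_dirichlet_eta)
     (use two_powr_neq_1[OF assms] in \<open>auto intro!: analytic_intros\<close>)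

text \<open>
  After one step, \<open>\<eta>(x) = 1/2 + T/2\<close> with \<open>T = (\<Sum>n. (-1)^n c n)\<close>; for real \<open>x \<ge> 0\<close> the differences
  \<open>c n\<close> are nonnegative with sum at most 1, which already forces \<open>T > -1\<close>.
\<close>
lemma dirichlet_eta_of_real_pos:
  fixes x :: real
  assumes "0 \<le> x"
  shows "\<exists>y>0. dirichlet_eta (of_real x) = of_real y"
proof -
  define c where "c = (\<lambda>n. (real n + 1) powr (-x) - (real n + 2) powr (-x))"
  define T where "T = (\<Sum>n. (-1) ^ n * c n)"
  have c_nonneg: "c n \<ge> 0" for n using assms by (auto simp: c_def intro!: powr_mono2')
  have "(\<Sum>n<N. c n) = 1 - (real N + 1) powr (-x)" for N
    by (induction N) (auto simp: c_def add_ac)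
  hence c_le: "(\<Sum>n<N. c n) \<le> 1" for N by simp
  have c_sum: "summable c" by (rule summableI_nonneg_bounded[OF c_nonneg c_le])
  have c_alt: "summable (\<lambda>n. (-1) ^ n * c n)"
    by (rule summable_norm_cancel) (use c_sum c_nonneg in \<open>simp add: abs_mult\<close>)
  have c: "powr_difference 1 (of_real x) (real n + 1) = of_real (c n)" for n
  proof -
    have "of_real (real n + 1) powr (- of_real x :: complex) = of_real ((real n + 1) powr (-x))"
         "of_real (real n + 2) powr (- of_real x :: complex) = of_real ((real n + 2) powr (-x))"
      using powr_of_real[of "real n + 1" "-x"] powr_of_real[of "real n + 2" "-x"] by simp_all
    thus ?thesis by (simp add: c_def add_ac)
  qed
  have alt_eq: "(\<lambda>n. (-1) ^ n * powr_difference 1 (of_real x) (real n + 1)) = (\<lambda>n. of_real ((-1) ^ n * c n))"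
    unfolding c by auto
  \<comment> \<open>One step does not meet the condition of \<open>dirichlet_eta_eq\<close> at
    \<open>x = 0\<close>, so two steps are taken and one is undone by
    \<open>eta_trafo_Suc\<close>.\<close>
  have "dirichlet_eta (of_real x) = eta_trafo (Suc 1) (of_real x)"
    using assms by (intro dirichlet_eta_eq) auto
  also have "\<dots> = eta_trafo 1 (of_real x)"
    by (rule eta_trafo_Suc) (simp only: alt_eq summable_of_real c_alt)
  also have "\<dots> = of_real (1 / 2 + T / 2)"
    unfolding eta_trafo_def alt_eq T_def suminf_of_real[OF c_alt, symmetric] by simp
  finally have eq: "dirichlet_eta (of_real x) = of_real (1 / 2 + T / 2)" .
  \<comment> \<open>For \<open>x > 0\<close> strictness comes from \<open>c 0 > 0\<close>; at
    \<open>x = 0\<close> all \<open>c n\<close> vanish and \<open>T = 0\<close>.\<close>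
  have "T > -1"
  proof (cases "x = 0")
    case True
    hence "c = (\<lambda>_. 0)" by (auto simp: c_def)
    thus ?thesis by (simp add: T_def)
  next
    case False
    hence "c 0 > 0" using assms by (auto simp: c_def powr_less_one)
    \<comment> \<open>Adding \<open>c\<close> leaves only nonnegative terms, the first being
      \<open>2 * c 0\<close>; hence \<open>T + 1 \<ge> 2 * c 0\<close>.\<close>
    have "(\<lambda>n. (-1) ^ n * c n + c n) sums (T + suminf c)"
      unfolding T_def by (intro sums_add summable_sums c_sum c_alt)
    moreover have "0 \<le> (-1) ^ n * c n + c n" for n
      using c_nonneg[of n] by (cases "even n") auto
    ultimately have "(\<Sum>n\<in>{0}. (-1) ^ n * c n + c n) \<le> T + suminf c"
      using sum_le_suminf[of "\<lambda>n. (-1) ^ n * c n + c n" "{0}"] by (auto simp: sums_iff)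
    moreover have "suminf c \<le> 1" by (rule suminf_le_const[OF c_sum c_le])
    ultimately show ?thesis using \<open>c 0 > 0\<close> by simp
  qed
  with eq show ?thesis by (intro exI[of _ "1 / 2 + T / 2"]) auto
qed

lemma zeta_of_real_neg:
  fixes x :: real
  assumes "0 \<le> x" "x < 1"
  shows "\<exists>y<0. zeta (of_real x) = of_real y"
proof -
  obtain y where y: "y > 0" "dirichlet_eta (of_real x) = of_real y"
    using dirichlet_eta_of_real_pos[OF assms(1)] by auto
  have "(2 powr (1 - of_real x) :: complex) = of_real (2 powr (1 - x))"
    using powr_of_real[of 2 "1 - x"] by simp
  hence "zeta (of_real x) = of_real (y / (1 - 2 powr (1 - x)))"
    by (simp add: zeta_def y)
  moreover have "2 powr (1 - x) > 1" using assms by simp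
  hence "y / (1 - 2 powr (1 - x)) < 0" using y by (simp add: divide_pos_neg)
  ultimately show ?thesis by blast
qed

subsection \<open>Continuation and sign of the multiple zeta function\<close>

text \<open>Newton's identity solved for the elementary symmetric function, with values of
  \<open>zeta\<close> as power sums.\<close>

fun multi_zeta :: "nat \<Rightarrow> complex \<Rightarrow> complex" where
  "multi_zeta 0 s = 1"
| "multi_zeta (Suc j) s =
     (\<Sum>i\<le>j. (-1) ^ i * zeta (of_nat (Suc i) * s) * multi_zeta (j - i) s) / of_nat (Suc j)"

declare multi_zeta.simps(2) [simp del]

lemma power_sum_powr:
  assumes "Re s > 1"
  shows "power_sum (\<lambda>m. of_nat m powr (-s)) {1..} (Suc i) = zeta (of_nat (Suc i) * s)"
proof -
  have "1 * Re s \<le> real (Suc i) * Re s"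
    using assms by (intro mult_right_mono) auto
  moreover have "Re (of_nat (Suc i) * s) = real (Suc i) * Re s" by simp
  ultimately have "Re (of_nat (Suc i) * s) > 1" using assms by linarith
  from has_sum_zeta[OF this]
  have eq: "(\<Sum>\<^sub>\<infinity>m\<in>{1..}. of_nat m powr (- (of_nat (Suc i) * s))) = zeta (of_nat (Suc i) * s)"
    by (rule infsumI)
  have "(of_nat m powr (-s)) ^ Suc i = (of_nat m powr (- (of_nat (Suc i) * s)) :: complex)"
    if "m \<in> {1..}" for m
    using that powr_power[of "of_nat m :: complex" "-s" "Suc i"] by simp
  hence "power_sum (\<lambda>m. of_nat m powr (-s)) {1..} (Suc i) =
      (\<Sum>\<^sub>\<infinity>m\<in>{1..}. of_nat m powr (- (of_nat (Suc i) * s)))"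
    unfolding power_sum_def by (rule infsum_cong)
  with eq show ?thesis by (simp only:)
qed

text \<open>By Newton's identity the series obeys the recursion that defines
  \<open>multi_zeta\<close>.\<close>

lemma euler_zagier_series_eq_multi_zeta:
  assumes "Re s > 1"
  shows "euler_zagier_series r s = multi_zeta r s"
  unfolding euler_zagier_series_eq_elem_sym
proof (induction r rule: less_induct)
  case (less r)
  let ?f = "\<lambda>m. of_nat m powr (-s)"
  show ?case
  proof (cases r)
    case 0
    thus ?thesis by (simp add: elem_sym_0)
  next
    case (Suc j)
    have "?f summable_on {1..}"
      using has_sum_zeta[OF assms] by (rule has_sum_imp_summable)
    hence "of_nat (Suc j) * elem_sym ?f {1..} (Suc j) =
        (\<Sum>i\<le>j. (-1) ^ i * zeta (of_nat (Suc i) * s) * elem_sym ?f {1..} (j - i))"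
      by (simp only: newton_identity power_sum_powr[OF assms])
    also have "\<dots> = (\<Sum>i\<le>j. (-1) ^ i * zeta (of_nat (Suc i) * s) * multi_zeta (j - i) s)"
      by (rule sum.cong[OF refl]) (simp only: less.IH[unfolded Suc] le_imp_less_Suc diff_le_self)
    also have "\<dots> = of_nat (Suc j) * multi_zeta (Suc j) s"
      by (simp add: multi_zeta.simps(2) del: of_nat_Suc)
    finally show ?thesis
      unfolding Suc by (simp del: of_nat_Suc)
  qed
qed

lemma meromorphic_multi_zeta: "multi_zeta r meromorphic_on UNIV"
proof (induction r rule: less_induct)
  case (less r)
  show ?case
  proof (cases r)
    case 0
    thus ?thesis by (simp add: meromorphic_on_const)
  next
    case (Suc j)
    have zeta: "(\<lambda>s. zeta (of_nat n * s)) meromorphic_on UNIV" for n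
      by (rule meromorphic_on_compose[OF meromorphic_zeta[of UNIV]]) (auto intro!: analytic_intros)
    have "multi_zeta (j - i) meromorphic_on UNIV" for i
      by (rule less.IH) (simp add: Suc)
    thus ?thesis
      unfolding Suc multi_zeta.simps(2)[abs_def] by (intro meromorphic_intros zeta)
  qed
qed

text \<open>The recursion evaluates \<open>zeta\<close> only at multiples \<open>k * s\<close> with
  \<open>1 \<le> k \<le> r\<close>, so it suffices to keep these off the line of real part
  1.\<close>

lemma analytic_multi_zeta:
  assumes "\<And>k. 1 \<le> k \<Longrightarrow> k \<le> r \<Longrightarrow> real k * Re s \<noteq> 1"
  shows "multi_zeta r analytic_on {s}"
  using assms
proof (induction r rule: less_induct)
  case (less r)
  show ?case
  proof (cases r)
    case 0
    thus ?thesis by (simp add: analytic_on_const)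
  next
    case (Suc j)
    have zeta: "(\<lambda>s. zeta (of_nat (Suc i) * s)) analytic_on {s}" if "i \<le> j" for i
    proof -
      have "real (Suc i) * Re s \<noteq> 1" using less.prems[of "Suc i"] that Suc by simp
      hence "zeta analytic_on (\<lambda>s. of_nat (Suc i) * s) ` {s}"
        using analytic_zeta[of "of_nat (Suc i) * s"] by simp
      moreover have "(\<lambda>s. of_nat (Suc i) * s) analytic_on {s}"
        by (intro analytic_intros)
      ultimately show ?thesis
        using analytic_on_compose[of "\<lambda>s. of_nat (Suc i) * s" "{s}" zeta] by (simp add: o_def)
    qed
    have "multi_zeta (j - i) analytic_on {s}" for i
      by (rule less.IH) (use less.prems Suc in auto)
    thus ?thesis
      unfolding Suc multi_zeta.simps(2)[abs_def] by (intro analytic_intros zeta) (simp_all del: of_nat_Suc)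
  qed
qed

text \<open>The recursion need not give 0 at poles or the limit at removable singularities.
  \<open>remove_sings\<close> corrects both and keeps the values at points of analyticity, among
  them all with \<open>Re s > 1\<close>.\<close>

lemma euler_zagier_zeta_eq_remove_sings:
  "euler_zagier_zeta r = remove_sings (multi_zeta r)"
proof (rule euler_zagier_zeta_eqI)
  have "remove_sings (multi_zeta r) s = euler_zagier_series r s" if "Re s > 1" for s
  proof -
    have "real k * Re s \<noteq> 1" if "k \<ge> 1" for k
    proof -
      have "1 * Re s \<le> real k * Re s"
        using \<open>Re s > 1\<close> that by (intro mult_right_mono) auto
      thus ?thesis using \<open>Re s > 1\<close> by linarith
    qed
    hence "multi_zeta r analytic_on {s}" by (intro analytic_multi_zeta)
    thus ?thesis using that by (simp add: euler_zagier_series_eq_multi_zeta)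
  qed
  thus "is_euler_zagier_continuation r (remove_sings (multi_zeta r))"
    unfolding is_euler_zagier_continuation_def
    using remove_sings_nicely_meromorphic[OF meromorphic_multi_zeta] by blast
qed

text \<open>The case \<open>r = 0\<close> is included because the recursion descends to it.\<close>

lemma multi_zeta_of_real_sign:
  fixes s :: real
  assumes "0 \<le> s" "real r * s < 1"
  shows "\<exists>y>0. multi_zeta r (of_real s) = of_real ((-1) ^ r * y)"
  using assms(2)
proof (induction r rule: less_induct)
  case (less r)
  show ?case
  proof (cases r)
    case 0
    thus ?thesis by (auto intro!: exI[of _ 1])
  next
    case (Suc j)
    have "\<exists>y>0. (-1) ^ i * zeta (of_nat (Suc i) * of_real s) * multi_zeta (j - i) (of_real s)
        = of_real ((-1) ^ Suc j * y)" if "i \<le> j" for i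
    proof -
      have le: "real k * s < 1" if "k \<le> r" for k
        using less.prems mult_right_mono[of "real k" "real r" s] that assms(1) by simp
      obtain y where y: "y < 0" "zeta (of_real (real (Suc i) * s)) = of_real y"
        using zeta_of_real_neg[of "real (Suc i) * s"] le[of "Suc i"] assms(1) Suc \<open>i \<le> j\<close> by auto
      obtain w where w: "w > 0" "multi_zeta (j - i) (of_real s) = of_real ((-1) ^ (j - i) * w)"
        using less.IH[of "j - i"] le[of "j - i"] Suc by (auto simp: less_Suc_eq_le)
      \<comment> \<open>The two sign factors give \<open>(-1) ^ j\<close> and the negative
        \<open>y\<close> supplies one more \<open>-1\<close>, so all summands share one sign and
        cannot cancel.\<close>
      have "(-1) ^ i * (-1) ^ (j - i) = ((-1) ^ j :: complex)"
        using \<open>i \<le> j\<close> by (simp flip: power_add)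
      hence "(-1) ^ i * zeta (of_nat (Suc i) * of_real s) * multi_zeta (j - i) (of_real s)
          = of_real ((-1) ^ Suc j * (- y * w))"
        using y(2) w(2) by (simp add: mult_ac)
      moreover have "- y * w > 0" using y(1) w(1) by (simp add: mult_neg_pos)
      ultimately show ?thesis by blast
    qed
    then obtain Y where Y: "\<And>i. i \<le> j \<Longrightarrow> Y i > 0"
      "\<And>i. i \<le> j \<Longrightarrow> (-1) ^ i * zeta (of_nat (Suc i) * of_real s) * multi_zeta (j - i) (of_real s)
        = of_real ((-1) ^ Suc j * Y i)"
      by metis
    have "multi_zeta r (of_real s) = (\<Sum>i\<le>j. of_real ((-1) ^ Suc j * Y i)) / of_nat (Suc j)"
      unfolding Suc multi_zeta.simps(2) by (subst sum.cong[OF refl Y(2)]) auto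
    also have "\<dots> = of_real ((-1) ^ r * ((\<Sum>i\<le>j. Y i) / real (Suc j)))"
      by (simp add: Suc sum_negf flip: sum_distrib_left)
    finally show ?thesis
      using Y(1) by (intro exI[of _ "(\<Sum>i\<le>j. Y i) / real (Suc j)"]) (auto intro!: divide_pos_pos sum_pos)
  qed
qed

theorem theorem1:
  fixes r :: nat and s :: real
  assumes "r \<ge> 1" and "0 \<le> s" and "s < 1 / real r"
  shows "euler_zagier_zeta r (complex_of_real s) \<in> \<real>
    \<and> (even r \<longrightarrow> Re (euler_zagier_zeta r (complex_of_real s)) > 0)
    \<and> (odd r \<longrightarrow> Re (euler_zagier_zeta r (complex_of_real s)) < 0)
    \<and> euler_zagier_zeta r (complex_of_real s) \<noteq> 0"
proof -
  have rs: "real r * s < 1" using assms by (simp add: field_simps)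
  \<comment> \<open>No multiple of s up to \<open>r * s\<close> reaches 1, so
    \<open>multi_zeta r\<close> is analytic at s and \<open>remove_sings\<close> keeps its
    value.\<close>
  have "real k * s \<noteq> 1" if "k \<le> r" for k
    using rs mult_right_mono[of "real k" "real r" s] that assms(2) by simp
  hence "multi_zeta r analytic_on {of_real s}" by (intro analytic_multi_zeta) auto
  hence "euler_zagier_zeta r (of_real s) = multi_zeta r (of_real s)"
    by (simp add: euler_zagier_zeta_eq_remove_sings)
  moreover obtain y where "y > 0" "multi_zeta r (of_real s) = of_real ((-1) ^ r * y)"
    using multi_zeta_of_real_sign[OF assms(2) rs] by blast
  ultimately show ?thesis by auto
qed

end
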